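(* In the setting of the context, let $P$ be a normal height-one prime with uniformiser $\pi$ (a prime of $\overline F\mathcal A$, or the place at infinity of a hypertangent top variable), and let $f\in L^*$ with $v_P(f)\ge-\delta_P$. Define the residue $$\tau_P(f):=\Bigl(f\,\frac{\pi}{D\pi}\Bigr)\Big|_P\in\kappa(P),$$ the class in the residue field $\kappa(P)$. Then: (i) $\tau_P(f)$ is independent of the choice of $\pi$, and for any $h\in(\overline F L)^*$ with $e:=v_P(h)\neq0$, $\tau_P(f)=e\cdot\bigl(f\,\tfrac{h}{Dh}\bigr)\big|_P$; (ii) $\tau_P(f)\neq0$ if and only if $v_P(f)=-\delta_P$; (iii) if $f$ has an elementary integral over $L$, with $(v,c_i,u_i)$ a representation $f=Dv+\sum_{i=1}^rc_iDu_i/u_i$ having the properties (A) and (B) listed in the context, then $$\tau_P(f)=\sum_{i=1}^rc_i\,v_P(u_i)\in\overline F:$$ every residue at a normal prime is a constant.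
   Context: All fields have characteristic $0$; $\overline F$ is an algebraic closure of $F$. $(L,D)$ is a differential field built as follows. (T1) $K_0=F(t_1,\dots,t_j)$ with $DF\subseteq F$, each $t_i$ transcendental over $F(t_1,\dots,t_{i-1})$ and $Dt_i\in F(t_1,\dots,t_i)$; $R_0=F[t_1,\dots,t_j]$. (T2) $y^m=q\in R_0$, where $q$ is $m$-th-power-free and $Y^m-q$ is irreducible over $\overline F(t_1,\dots,t_j)$. (T3) $t_{j+1},\dots,t_n$ are successively transcendental over the field below, with $Dt_i\in K_0(y)(t_{j+1},\dots,t_i)$. (T4) $L=K_0(y)(t_{j+1},\dots,t_n)$ has field of constants $F$. $\mathcal O$ is the integral closure of $R_0$ in $K_0(y)$, $\mathcal A=\mathcal O[t_{j+1},\dots,t_n]$, and $\overline F\mathcal A=\overline F\otimes_F\mathcal A$, a Krull domain with fraction field $\overline F L$; $D$ extends uniquely to $\overline F L$ with $D\overline F=0$. For a height-one prime $P$ of $\overline F\mathcal A$: $v_P$ is its valuation, $\eta_P:=\max(0,\sup_{a\in\overline F\mathcal A\setminus\{0\}}(-v_P(Da)))$ (finite), $\delta_P:=1+\eta_P$; with $h_0\in(\overline F L)^*$, $v_P(h_0)=\eta_P$, $\overline D_P:=h_0D$, and $\pi$ a uniformiser, $P$ is special if $v_P(\overline D_P\pi)\ge1$ and normal if $v_P(\overline D_P\pi)=0$. Hypertangent top variable: $Dt_n=w(1+t_n^2)$ with $w\in E^*$, $E=K_0(y)(t_{j+1},\dots,t_{n-1})$; its place at infinity is the degree valuation $v_\infty(a/b)=\deg_{t_n}b-\deg_{t_n}a$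 of $\overline F L$, with uniformiser $1/t_n$; it is normal (same definitions) with $\eta=0$, $\delta=1$. $f$ has an elementary integral over $L$ if $f=Dg$ for some $g$ in an elementary extension of $L$. In that case there is a representation $f=Dv+\sum_{i=1}^rc_iDu_i/u_i$ with $v\in L$, $c_i\in\overline F$, $u_i\in(\overline F L)^*$ such that: (A) at every normal height-one prime $P$ of $\overline F\mathcal A$, $v_P(v)\ge\min(0,v_P(f)+\delta_P)$, with equality $v_P(v)=v_P(f)+\delta_P$ whenever $v_P(v)<0$ (so the polar divisor of $v$ restricted to the normal primes is at most $\sum(-v_P(f)-\delta_P)P$ over normal $P$ with $v_P(f)\le-\delta_P-1$); (B) every $\operatorname{div}(u_i)$ is supported on $S=\{P\text{ special}\}\cup\{P\text{ normal}:v_P(f)\le-\delta_P\}$. *)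

theory Defs
  imports "HOL-Algebra.Algebra" "HOL-Algebra.Algebraic_Closure_Type" "HOL-Library.Extended_Real"
begin

section \<open>Conventions\<close>

text \<open>
  The type \<open>'a\<close> plays the role of the field \<open>Fbar L\<close>; the fields and rings \<open>F\<close>, \<open>Fbar\<close>, \<open>K0\<close>, \<open>L\<close>,
  \<open>R0\<close>, \<open>\<O>\<close>, \<open>\<A>\<close>, ... are subsets of it, regarded as substructures of the ring
  \<^const>\<open>ring_of_type_algebra\<close> of all elements of the type.  The generators are
  \<open>t 1, \<dots>, t n\<close>; the value \<open>t 0\<close> is never used.
\<close>

abbreviation sub_ring :: "'a::field set \<Rightarrow> 'a ring" where
  "sub_ring A \<equiv> ring_of_type_algebra\<lparr>carrier := A\<rparr>"

abbreviation adjoin :: "'a::field set \<Rightarrow> 'a set \<Rightarrow> 'a set" where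
  "adjoin K S \<equiv> generate_field ring_of_type_algebra (K \<union> S)"

abbreviation adjoin_ring :: "'a::field set \<Rightarrow> 'a set \<Rightarrow> 'a set" where
  "adjoin_ring A S \<equiv> generate_ring ring_of_type_algebra (A \<union> S)"

abbreviation transcendental_over :: "'a::field set \<Rightarrow> 'a \<Rightarrow> bool" where
  "transcendental_over K x \<equiv> ring.transcendental ring_of_type_algebra K x"

definition derivation :: "('a::field \<Rightarrow> 'a) \<Rightarrow> bool" where
  "derivation D \<longleftrightarrow> (\<forall>x y. D (x + y) = D x + D y) \<and> (\<forall>x y. D (x * y) = D x * y + x * D y)"

section \<open>The tower\<close>

definition base_field :: "'a::field set \<Rightarrow> (nat \<Rightarrow> 'a) \<Rightarrow> nat \<Rightarrow> 'a set" where
  "base_field F t i = adjoin F (t ` {1..i})"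

definition base_ring :: "'a::field set \<Rightarrow> (nat \<Rightarrow> 'a) \<Rightarrow> nat \<Rightarrow> 'a set" where
  "base_ring F t i = adjoin_ring F (t ` {1..i})"

text \<open>
  \<open>K0(y)(t (j+1), \<dots>, t i)\<close> for \<open>j \<le> i\<close>; in particular \<open>i = j\<close> gives \<open>K0(y)\<close> and \<open>i = n\<close> gives \<open>L\<close>.
\<close>
definition upper_field :: "'a::field set \<Rightarrow> (nat \<Rightarrow> 'a) \<Rightarrow> nat \<Rightarrow> 'a \<Rightarrow> nat \<Rightarrow> 'a set" where
  "upper_field F t j y i = adjoin (adjoin (base_field F t j) {y}) (t ` {j+1..i})"

definition power_free :: "nat \<Rightarrow> 'a::field set \<Rightarrow> 'a \<Rightarrow> bool" where
  "power_free m R q \<longleftrightarrow>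
     (\<forall>p\<in>R. p ^ m divides\<^bsub>sub_ring R\<^esub> q \<longrightarrow> p \<in> Units (sub_ring R))"

text \<open>The polynomial \<open>Y ^ m - q\<close> in \<open>K[Y]\<close>.\<close>
definition radical_poly :: "'a::field set \<Rightarrow> nat \<Rightarrow> 'a \<Rightarrow> 'a list" where
  "radical_poly K m q =
     X\<^bsub>ring_of_type_algebra\<^esub> [^]\<^bsub>K[X]\<^bsub>ring_of_type_algebra\<^esub>\<^esub> m
       \<ominus>\<^bsub>K[X]\<^bsub>ring_of_type_algebra\<^esub>\<^esub> ring.poly_of_const ring_of_type_algebra q"

text \<open>
  The derivation \<open>D\<close> is the unique extension to \<open>Fbar L\<close> of the derivation of \<open>L\<close>; that \<open>L\<close> is
  closed under \<open>D\<close> follows from the assumptions on the generators.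
\<close>
locale differential_tower =
  fixes F Fbar :: "'a::field_char_0 set" and D :: "'a \<Rightarrow> 'a" and t :: "nat \<Rightarrow> 'a"
    and q y :: 'a and m j n :: nat
  assumes F_subfield: "subfield F ring_of_type_algebra"
    and Fbar_subfield: "subfield Fbar ring_of_type_algebra"
    and Fbar_closure: "algebraic_closure (sub_ring Fbar) F"
    and generated: "adjoin Fbar (upper_field F t j y n) = UNIV"
    and D_derivation: "derivation D"
    and D_Fbar: "\<forall>c\<in>Fbar. D c = 0"
    and j_le_n: "j \<le> n"
    and D_F: "D ` F \<subseteq> F"
    and t_lower_trans: "\<forall>i\<in>{1..j}. transcendental_over (base_field F t (i - 1)) (t i)"
    and D_t_lower: "\<forall>i\<in>{1..j}. D (t i) \<in> base_field F t i"
    and m_pos: "m \<ge> 1"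
    and q_in: "q \<in> base_ring F t j"
    and y_power: "y ^ m = q"
    and q_power_free: "power_free m (base_ring F t j) q"
    and radical_irreducible:
      "pirreducible\<^bsub>ring_of_type_algebra\<^esub> (base_field Fbar t j)
         (radical_poly (base_field Fbar t j) m q)"
    and t_upper_trans: "\<forall>i\<in>{j+1..n}. transcendental_over (upper_field F t j y (i - 1)) (t i)"
    and D_t_upper: "\<forall>i\<in>{j+1..n}. D (t i) \<in> upper_field F t j y i"
    and constants: "{x \<in> upper_field F t j y n. D x = 0} = F"

definition integral_closure :: "'a::field set \<Rightarrow> 'a set \<Rightarrow> 'a set" where
  "integral_closure R K =
     {x \<in> K. \<exists>p :: 'a poly. lead_coeff p = 1 \<and> set (coeffs p) \<subseteq> R \<and> poly p x = 0}"

definition ring_O :: "'a::field set \<Rightarrow> (nat \<Rightarrow> 'a) \<Rightarrow> nat \<Rightarrow> 'a \<Rightarrow> 'a set" where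
  "ring_O F t j y = integral_closure (base_ring F t j) (adjoin (base_field F t j) {y})"

definition ring_A :: "'a::field set \<Rightarrow> (nat \<Rightarrow> 'a) \<Rightarrow> nat \<Rightarrow> 'a \<Rightarrow> nat \<Rightarrow> 'a set" where
  "ring_A F t j y n = adjoin_ring (ring_O F t j y) (t ` {j+1..n})"

text \<open>
  \<open>Fbar \<otimes>\<^bsub>F\<^esub> \<A>\<close>, realised as the subring of \<open>Fbar L\<close> generated by \<open>Fbar\<close> and \<open>\<A>\<close>: elements of \<open>L\<close>
  algebraic over its field of constants \<open>F\<close> are constants, so \<open>F\<close> is algebraically closed in \<open>L\<close>
  and \<open>Fbar\<close> and \<open>L\<close> are linearly disjoint over \<open>F\<close>.
\<close>
definition ring_FA :: "'a::field set \<Rightarrow> 'a set \<Rightarrow> (nat \<Rightarrow> 'a) \<Rightarrow> nat \<Rightarrow> 'a \<Rightarrow> nat \<Rightarrow> 'a set" where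
  "ring_FA F Fbar t j y n = adjoin_ring Fbar (ring_A F t j y n)"

section \<open>Valuations\<close>

text \<open>
  Valuations are integer-valued functions whose value at \<open>0\<close> is irrelevant; \<open>ext_val v\<close> is the
  extension with value \<open>\<infinity>\<close> at \<open>0\<close>.
\<close>
definition ext_val :: "('a::field \<Rightarrow> int) \<Rightarrow> 'a \<Rightarrow> ereal" where
  "ext_val v x = (if x = 0 then \<infinity> else ereal (of_int (v x)))"

definition uniformiser :: "('a::field \<Rightarrow> int) \<Rightarrow> 'a \<Rightarrow> bool" where
  "uniformiser v p \<longleftrightarrow> p \<noteq> 0 \<and> v p = 1"

definition discrete_valuation :: "('a::field \<Rightarrow> int) \<Rightarrow> bool" where
  "discrete_valuation v \<longleftrightarrow>
     (\<forall>x y. x \<noteq> 0 \<longrightarrow> y \<noteq> 0 \<longrightarrow> v (x * y) = v x + v y) \<and>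
     (\<forall>x y. x \<noteq> 0 \<longrightarrow> y \<noteq> 0 \<longrightarrow> x + y \<noteq> 0 \<longrightarrow> min (v x) (v y) \<le> v (x + y)) \<and>
     (\<exists>p. uniformiser v p)"

definition valuation_ring :: "('a::field \<Rightarrow> int) \<Rightarrow> 'a set" where
  "valuation_ring v = {x. 0 \<le> ext_val v x}"

definition valuation_ideal :: "('a::field \<Rightarrow> int) \<Rightarrow> 'a set" where
  "valuation_ideal v = {x. 0 < ext_val v x}"

definition height_one_prime :: "'a::field set \<Rightarrow> 'a set \<Rightarrow> bool" where
  "height_one_prime B P \<longleftrightarrow> primeideal P (sub_ring B) \<and> P \<noteq> {0} \<and>
     (\<forall>Q. primeideal Q (sub_ring B) \<longrightarrow> Q \<subseteq> P \<longrightarrow> Q = {0} \<or> Q = P)"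

text \<open>
  \<open>v\<close> is the valuation of the prime \<open>P\<close> of the Krull domain \<open>B\<close>: the normalised discrete valuation
  of the fraction field whose valuation ring is the localisation of \<open>B\<close> at \<open>P\<close>.
\<close>
definition prime_valuation :: "'a::field set \<Rightarrow> 'a set \<Rightarrow> ('a \<Rightarrow> int) \<Rightarrow> bool" where
  "prime_valuation B P v \<longleftrightarrow> discrete_valuation v \<and>
     valuation_ring v = {a / b | a b. a \<in> B \<and> b \<in> B - P}"

text \<open>
  The residue field at a height-one prime \<open>P\<close> of \<open>B\<close> is the residue field of the localisation of
  \<open>B\<close> at \<open>P\<close>.  Constants embed in it through their classes.
\<close>
definition residue_field :: "('a::field \<Rightarrow> int) \<Rightarrow> 'a set ring" where
  "residue_field v = sub_ring (valuation_ring v) Quot valuation_ideal v"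

definition residue_class :: "('a::field \<Rightarrow> int) \<Rightarrow> 'a \<Rightarrow> 'a set" where
  "residue_class v x = valuation_ideal v +>\<^bsub>sub_ring (valuation_ring v)\<^esub> x"

text \<open>
  In the following, \<open>B\<close> is the ring over which the supremum defining \<open>\<eta>\<close> is taken: \<open>Fbar \<A>\<close> for a
  height-one prime and the valuation ring for the place at infinity.  The supremum is taken in the
  extended reals, where \<open>D a = 0\<close> contributes \<open>-\<infinity>\<close>.
\<close>
definition eta :: "('a::field \<Rightarrow> 'a) \<Rightarrow> 'a set \<Rightarrow> ('a \<Rightarrow> int) \<Rightarrow> ereal" where
  "eta D B v = max 0 (SUP a \<in> B - {0}. - ext_val v (D a))"

definition delta :: "('a::field \<Rightarrow> 'a) \<Rightarrow> 'a set \<Rightarrow> ('a \<Rightarrow> int) \<Rightarrow> ereal" where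
  "delta D B v = 1 + eta D B v"

definition special_place :: "('a::field \<Rightarrow> 'a) \<Rightarrow> 'a set \<Rightarrow> ('a \<Rightarrow> int) \<Rightarrow> bool" where
  "special_place D B v \<longleftrightarrow> (\<exists>h0 p. h0 \<noteq> 0 \<and> ext_val v h0 = eta D B v \<and> uniformiser v p \<and>
     ext_val v (h0 * D p) \<ge> 1)"

definition normal_place :: "('a::field \<Rightarrow> 'a) \<Rightarrow> 'a set \<Rightarrow> ('a \<Rightarrow> int) \<Rightarrow> bool" where
  "normal_place D B v \<longleftrightarrow> (\<exists>h0 p. h0 \<noteq> 0 \<and> ext_val v h0 = eta D B v \<and> uniformiser v p \<and>
     ext_val v (h0 * D p) = 0)"

definition hypertangent ::
  "'a::field set \<Rightarrow> ('a \<Rightarrow> 'a) \<Rightarrow> (nat \<Rightarrow> 'a) \<Rightarrow> 'a \<Rightarrow> nat \<Rightarrow> nat \<Rightarrow> bool" where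
  "hypertangent F D t y j n \<longleftrightarrow> j < n \<and>
     (\<exists>w \<in> upper_field F t j y (n - 1) - {0}. D (t n) = w * (1 + (t n)\<^sup>2))"

text \<open>\<open>v\<close> is the degree valuation of \<open>K(x)\<close>, where \<open>x\<close> is transcendental over \<open>K\<close>.\<close>
definition degree_valuation :: "'a::field set \<Rightarrow> 'a \<Rightarrow> ('a \<Rightarrow> int) \<Rightarrow> bool" where
  "degree_valuation K x v \<longleftrightarrow>
     (\<forall>a b :: 'a poly. set (coeffs a) \<subseteq> K \<longrightarrow> set (coeffs b) \<subseteq> K \<longrightarrow> a \<noteq> 0 \<longrightarrow> b \<noteq> 0 \<longrightarrow>
        v (poly a x / poly b x) = int (Polynomial.degree b) - int (Polynomial.degree a))"

definition residue :: "('a::field \<Rightarrow> 'a) \<Rightarrow> ('a \<Rightarrow> int) \<Rightarrow> 'a \<Rightarrow> 'a \<Rightarrow> 'a set" where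
  "residue D v p f = residue_class v (f * (p / D p))"

section \<open>Elementary integrals\<close>

definition elementary_generator :: "('b::field \<Rightarrow> 'b) \<Rightarrow> 'b set \<Rightarrow> 'b \<Rightarrow> bool" where
  "elementary_generator D M x \<longleftrightarrow>
     \<not> transcendental_over M x \<or>
     (\<exists>a \<in> M - {0}. D x = D a / a) \<or>
     (x \<noteq> 0 \<and> (\<exists>a \<in> M. D x / x = D a))"

inductive elementary_extension :: "('b::field \<Rightarrow> 'b) \<Rightarrow> 'b set \<Rightarrow> 'b set \<Rightarrow> bool"
  for D K where
    base: "elementary_extension D K K"
  | step: "\<lbrakk>elementary_extension D K M; elementary_generator D M x\<rbrakk>
      \<Longrightarrow> elementary_extension D K (adjoin M {x})"

text \<open>
  Elementary extensions of \<open>L\<close> need not embed in \<open>Fbar L\<close>; they live in an arbitrary differential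
  field \<open>'b\<close> into which \<open>L\<close> is embedded by \<open>\<phi>\<close>.
\<close>
definition has_elementary_integral ::
  "'b::field itself \<Rightarrow> 'a::field set \<Rightarrow> ('a \<Rightarrow> 'a) \<Rightarrow> 'a \<Rightarrow> bool" where
  "has_elementary_integral _ L D f \<longleftrightarrow>
     (\<exists>(\<phi> :: 'a \<Rightarrow> 'b) D' M g.
        \<phi> \<in> ring_hom (sub_ring L) ring_of_type_algebra \<and> derivation D' \<and>
        (\<forall>x\<in>L. D' (\<phi> x) = \<phi> (D x)) \<and>
        elementary_extension D' (\<phi> ` L) M \<and> g \<in> M \<and> D' g = \<phi> f)"

definition represents ::
  "'a::field set \<Rightarrow> 'a set \<Rightarrow> ('a \<Rightarrow> 'a) \<Rightarrow> 'a \<Rightarrow> 'a \<Rightarrow> nat \<Rightarrow> (nat \<Rightarrow> 'a) \<Rightarrow> (nat \<Rightarrow> 'a) \<Rightarrow> bool" where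
  "represents L Fbar D f v r c u \<longleftrightarrow> v \<in> L \<and> (\<forall>i\<in>{1..r}. c i \<in> Fbar \<and> u i \<noteq> 0) \<and>
     f = D v + (\<Sum>i=1..r. c i * (D (u i) / u i))"

definition property_A :: "'a::field set \<Rightarrow> ('a \<Rightarrow> 'a) \<Rightarrow> 'a \<Rightarrow> 'a \<Rightarrow> bool" where
  "property_A B D f v \<longleftrightarrow>
     (\<forall>Q vQ. height_one_prime B Q \<longrightarrow> prime_valuation B Q vQ \<longrightarrow> normal_place D B vQ \<longrightarrow>
        ext_val vQ v \<ge> min 0 (ext_val vQ f + delta D B vQ) \<and>
        (ext_val vQ v < 0 \<longrightarrow> ext_val vQ v = ext_val vQ f + delta D B vQ))"

definition property_B :: "'a::field set \<Rightarrow> ('a \<Rightarrow> 'a) \<Rightarrow> 'a \<Rightarrow> nat \<Rightarrow> (nat \<Rightarrow> 'a) \<Rightarrow> bool" where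
  "property_B B D f r u \<longleftrightarrow>
     (\<forall>i\<in>{1..r}. \<forall>Q vQ. height_one_prime B Q \<longrightarrow> prime_valuation B Q vQ \<longrightarrow> vQ (u i) \<noteq> 0 \<longrightarrow>
        special_place D B vQ \<or> normal_place D B vQ \<and> ext_val vQ f \<le> - delta D B vQ)"

end

theory Submission
  imports Defs
begin

text \<open>
  At a normal place, \<open>h0 D\<close> maps the valuation ring into itself and sends uniformisers to units.
  Writing \<open>x = p\<^sup>e u\<close> with a uniformiser \<open>p\<close> and a unit \<open>u\<close>, the logarithmic derivatives therefore
  satisfy \<open>h0 D x / x = e h0 D p / p + O(1)\<close>, where \<open>h0 D p / p\<close> has value exactly \<open>-1\<close>.  All claims
  about residues are consequences of this congruence, since a nonzero integer \<open>e\<close> is a unit.  Both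
  kinds of places satisfy these two conditions: at a height-one prime by the quotient rule, and at
  infinity with \<open>h0 = 1\<close>, because the valuation ring is a localisation of \<open>K[1/t\<^sub>n]\<close>.
\<close>

section \<open>Subfields expressed through the operations of the type\<close>

lemma ring_ops [simp]:
  "carrier ring_of_type_algebra = UNIV"
  "x \<otimes>\<^bsub>ring_of_type_algebra\<^esub> y = x * y" "x \<oplus>\<^bsub>ring_of_type_algebra\<^esub> y = x + y"
  "\<one>\<^bsub>ring_of_type_algebra\<^esub> = 1" "\<zero>\<^bsub>ring_of_type_algebra\<^esub> = 0"
  by (simp_all add: ring_of_type_algebra_def)

lemma a_inv_ring_of_type_algebra [simp]:
  "\<ominus>\<^bsub>ring_of_type_algebra\<^esub> x = - (x :: 'a :: field)"
proof -
  interpret R: field "ring_of_type_algebra :: 'a ring" by (rule field_from_type_algebra)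
  show ?thesis using R.minus_equality[of "- x" x] by simp
qed

lemma m_inv_ring_of_type_algebra [simp]:
  assumes "x \<noteq> 0" shows "inv\<^bsub>ring_of_type_algebra\<^esub> x = inverse (x :: 'a :: field)"
proof -
  interpret R: field "ring_of_type_algebra :: 'a ring" by (rule field_from_type_algebra)
  show ?thesis using R.comm_inv_char[of x "inverse x"] assms by simp
qed

text \<open>The convention \<open>inverse 0 = 0\<close> makes closure under inversion harmless at
  zero, so no element has to be excluded.\<close>

lemma subfield_type_iff:
  "subfield (K :: 'a::field set) ring_of_type_algebra \<longleftrightarrow>
     1 \<in> K \<and> (\<forall>x\<in>K. \<forall>y\<in>K. x + y \<in> K \<and> x * y \<in> K) \<and> (\<forall>x\<in>K. - x \<in> K \<and> inverse x \<in> K)"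
  (is "_ \<longleftrightarrow> ?R")
proof
  interpret R: field "ring_of_type_algebra :: 'a ring" by (rule field_from_type_algebra)
  {
    assume K: "subfield K ring_of_type_algebra"
    note sub = subringE[OF subfieldE(1)[OF K]]
    have "inverse x \<in> K" if "x \<in> K" for x
    proof (cases "x = 0")
      case False
      then show ?thesis using R.subfield_m_inv(1)[OF K, of x] that by simp
    qed (use that in simp)
    then show ?R using sub by simp
  next
    assume K: ?R
    then have "0 \<in> K" by (metis add.right_inverse)
    show "subfield K ring_of_type_algebra"
      by (rule R.subfieldI', rule R.subringI) (use K in auto)
  }
qed

lemma subfieldD:
  assumes "subfield (K :: 'a::field set) ring_of_type_algebra"
  shows "0 \<in> K" "1 \<in> K" "x \<in> K \<Longrightarrow> y \<in> K \<Longrightarrow> x + y \<in> K" "x \<in> K \<Longrightarrow> y \<in> K \<Longrightarrow> x * y \<in> K"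
    "x \<in> K \<Longrightarrow> - x \<in> K" "x \<in> K \<Longrightarrow> inverse x \<in> K" "x \<in> K \<Longrightarrow> y \<in> K \<Longrightarrow> x - y \<in> K"
    "x \<in> K \<Longrightarrow> y \<in> K \<Longrightarrow> x / y \<in> K"
proof -
  have K: "1 \<in> K" "\<And>x y. x \<in> K \<Longrightarrow> y \<in> K \<Longrightarrow> x + y \<in> K"
    "\<And>x y. x \<in> K \<Longrightarrow> y \<in> K \<Longrightarrow> x * y \<in> K"
    "\<And>x. x \<in> K \<Longrightarrow> - x \<in> K" "\<And>x. x \<in> K \<Longrightarrow> inverse x \<in> K"
    using assms unfolding subfield_type_iff by auto
  show "0 \<in> K" using K by (metis add.right_inverse)
  show "x \<in> K \<Longrightarrow> y \<in> K \<Longrightarrow> x - y \<in> K" using K(2)[of x "- y"] K(4)[of y] by simp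
  show "x \<in> K \<Longrightarrow> y \<in> K \<Longrightarrow> x / y \<in> K" using K(3)[of x "inverse y"] K(5)[of y]
    by (simp add: divide_inverse)
qed (use assms in \<open>auto simp: subfield_type_iff\<close>)

lemma subfield_sum:
  assumes "subfield (K :: 'a::field set) ring_of_type_algebra" "\<And>i. i \<in> I \<Longrightarrow> g i \<in> K"
  shows "sum g I \<in> K"
  using assms(2) by (induction I rule: infinite_finite_induct) (auto intro: subfieldD[OF assms(1)])

lemma subfield_of_nat:
  assumes "subfield (K :: 'a::field set) ring_of_type_algebra"
  shows "of_nat k \<in> K"
  by (induction k) (auto intro: subfieldD[OF assms])

lemma subfield_of_int:
  assumes "subfield (K :: 'a::field set) ring_of_type_algebra"
  shows "of_int k \<in> K"
  by (cases k) (auto intro: subfieldD[OF assms] subfield_of_nat[OF assms] simp del: of_nat_Suc)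

lemma subfield_power:
  assumes "subfield (K :: 'a::field set) ring_of_type_algebra" "x \<in> K"
  shows "x ^ k \<in> K"
  by (induction k) (auto intro: subfieldD[OF assms(1)] assms(2))

lemma subfield_generate_field: "subfield (generate_field ring_of_type_algebra (S :: 'a::field set)) ring_of_type_algebra"
proof -
  interpret R: field "ring_of_type_algebra :: 'a ring" by (rule field_from_type_algebra)
  show ?thesis by (rule R.generate_field_is_subfield) simp
qed

lemma generate_field_subset:
  assumes "subfield (K :: 'a::field set) ring_of_type_algebra" "S \<subseteq> K"
  shows "generate_field ring_of_type_algebra S \<subseteq> K"
proof -
  interpret R: field "ring_of_type_algebra :: 'a ring" by (rule field_from_type_algebra)
  show ?thesis by (rule R.generate_field_min_subfield1) (use assms in auto)
qed

lemma subset_generate_field: "S \<subseteq> generate_field R S"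
  by (auto intro: generate_field.incl)

section \<open>Derivations\<close>

context
  fixes D :: "'a::field_char_0 \<Rightarrow> 'a"
  assumes D: "derivation D"
begin

lemma derivation_add: "D (x + y) = D x + D y"
  and derivation_mult: "D (x * y) = D x * y + x * D y"
  using D unfolding derivation_def by blast+

lemma derivation_0 [simp]: "D 0 = 0"
  using derivation_add[of 0 0] by simp

lemma derivation_1 [simp]: "D 1 = 0"
  using derivation_mult[of 1 1] by simp

lemma derivation_minus: "D (- x) = - D x"
  using derivation_add[of x "- x"] by (simp add: eq_neg_iff_add_eq_0 add.commute)

text \<open>For \<open>x \<noteq> 0\<close>, differentiate \<open>x * inverse x = 1\<close>. At zero
  both sides vanish, so this rule and the quotient rule below need no side condition.\<close>

lemma derivation_inverse: "D (inverse x) = - D x * (inverse x * inverse x)"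
proof (cases "x = 0")
  case False
  then show ?thesis
    using derivation_mult[of x "inverse x"] by (simp add: field_simps add_eq_0_iff)
qed simp

lemma derivation_divide: "D (x / y) = D x / y - x * D y / (y * y)"
  unfolding divide_inverse by (simp add: derivation_mult derivation_inverse algebra_simps)

text \<open>For \<open>k = 0\<close> the truncated exponent \<open>k - 1\<close> is harmless,
  because the factor \<open>of_nat k\<close> vanishes.\<close>

lemma derivation_power: "D (x ^ k) = of_nat k * x ^ (k - 1) * D x"
proof (induction k)
  case (Suc k)
  then show ?case by (cases k) (simp_all add: derivation_mult algebra_simps)
qed simp

text \<open>The elements of the generated field whose derivative stays in it form a subfield
  containing the generators; by minimality this is the whole field. Closure of the tower under
  \<open>D\<close> is thereby reduced to its generators.\<close>

lemma derivation_closed_generate_field: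
  assumes "\<And>x. x \<in> S \<Longrightarrow> D x \<in> generate_field ring_of_type_algebra S"
    and "x \<in> generate_field ring_of_type_algebra S"
  shows "D x \<in> generate_field ring_of_type_algebra S"
proof -
  let ?K = "generate_field ring_of_type_algebra S"
  note K = subfieldD[OF subfield_generate_field[of S]]
  have "subfield {x \<in> ?K. D x \<in> ?K} ring_of_type_algebra"
    unfolding subfield_type_iff
  proof (intro conjI ballI)
    show "1 \<in> {x \<in> ?K. D x \<in> ?K}" using K(1,2) by simp
    fix a assume "a \<in> {x \<in> ?K. D x \<in> ?K}"
    then have a: "a \<in> ?K" "D a \<in> ?K" by auto
    show "- a \<in> {x \<in> ?K. D x \<in> ?K}" using K(5) a by (simp add: derivation_minus)
    have "- D a * (inverse a * inverse a) \<in> ?K" by (intro K a)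
    then show "inverse a \<in> {x \<in> ?K. D x \<in> ?K}" using K(6)[OF a(1)] by (simp add: derivation_inverse)
    fix b assume "b \<in> {x \<in> ?K. D x \<in> ?K}"
    then have b: "b \<in> ?K" "D b \<in> ?K" by auto
    show "a + b \<in> {x \<in> ?K. D x \<in> ?K}" using K(3) a b by (simp add: derivation_add)
    have "D a * b + a * D b \<in> ?K" by (intro K a b)
    then show "a * b \<in> {x \<in> ?K. D x \<in> ?K}" using K(4)[OF a(1) b(1)] by (simp add: derivation_mult)
  qed
  moreover have "S \<subseteq> {x \<in> ?K. D x \<in> ?K}"
    using assms(1) by (auto intro: generate_field.incl)
  ultimately have "?K \<subseteq> {x \<in> ?K. D x \<in> ?K}" by (rule generate_field_subset)
  then show ?thesis using assms(2) by blast
qed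

lemma dlog_mult:
  assumes "x \<noteq> 0" "y \<noteq> 0"
  shows "D (x * y) / (x * y) = D x / x + D y / y"
  using assms by (simp add: derivation_mult field_simps)

lemma dlog_inverse: "D (inverse x) / inverse x = - (D x / x)"
  unfolding derivation_inverse by (simp add: field_simps)

lemma dlog_power_int:
  assumes "x \<noteq> 0"
  shows "D (x powi k) / (x powi k) = of_int k * (D x / x)"
proof -
  have nat: "D (x ^ i) / (x ^ i) = of_nat i * (D x / x)" for i
    using assms unfolding derivation_power by (cases i) (simp_all del: of_nat_Suc)
  show ?thesis
  proof (cases "k \<ge> 0")
    case True
    then show ?thesis using nat[of "nat k"] by (simp add: power_int_def)
  next
    case False
    then show ?thesis using nat[of "nat (- k)"] dlog_inverse[of "x ^ nat (- k)"]
      by (simp add: power_int_def power_inverse)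
  qed
qed

end

section \<open>Discrete valuations\<close>

text \<open>Zero counts as having infinite order. Bounds stay in the integers and combine under sums
  and products without separate treatment of zero.\<close>

definition val_ge :: "('a::field \<Rightarrow> int) \<Rightarrow> int \<Rightarrow> 'a \<Rightarrow> bool" where
  "val_ge v k x \<longleftrightarrow> x = 0 \<or> k \<le> v x"

lemma val_ge_ext_val: "val_ge v k x \<longleftrightarrow> ereal (of_int k) \<le> ext_val v x"
  by (auto simp: val_ge_def ext_val_def)

lemma valuation_ring_iff: "x \<in> valuation_ring v \<longleftrightarrow> val_ge v 0 x"
  by (auto simp: valuation_ring_def val_ge_def ext_val_def)

lemma valuation_ideal_iff: "x \<in> valuation_ideal v \<longleftrightarrow> val_ge v 1 x"
  by (auto simp: valuation_ideal_def val_ge_def ext_val_def)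

lemma val_ge_0 [simp]: "val_ge v k 0"
  by (simp add: val_ge_def)

lemma val_ge_mono: "val_ge v k x \<Longrightarrow> l \<le> k \<Longrightarrow> val_ge v l x"
  by (auto simp: val_ge_def)

locale valued_field =
  fixes v :: "'a::field \<Rightarrow> int"
  assumes discrete: "discrete_valuation v"
begin

lemma val_mult: "x \<noteq> 0 \<Longrightarrow> y \<noteq> 0 \<Longrightarrow> v (x * y) = v x + v y"
  using discrete unfolding discrete_valuation_def by blast

lemma val_1 [simp]: "v 1 = 0"
  using val_mult[of 1 1] by simp

lemma val_uminus [simp]: "v (- x) = v x"
proof (cases "x = 0")
  case False
  \<comment> \<open>Twice this value is \<open>v 1 = 0\<close>, and the integers have no
    torsion.\<close>
  have "v (- 1) = 0" using val_mult[of "- 1" "- 1"] by simp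
  then show ?thesis using val_mult[of "- 1" x] False by simp
qed simp

lemma val_inverse: "v (inverse x) = - v x" if "x \<noteq> 0"
  using val_mult[of x "inverse x"] that by simp

lemma val_divide: "x \<noteq> 0 \<Longrightarrow> y \<noteq> 0 \<Longrightarrow> v (x / y) = v x - v y"
  using val_mult[of x "inverse y"] val_inverse[of y] by (simp add: divide_inverse)

lemma val_power: "x \<noteq> 0 \<Longrightarrow> v (x ^ k) = int k * v x"
  by (induction k) (auto simp: val_mult algebra_simps)

lemma val_power_int: "x \<noteq> 0 \<Longrightarrow> v (x powi k) = k * v x"
  by (auto simp: power_int_def val_power val_inverse)

lemma val_ge_add: "val_ge v k x \<Longrightarrow> val_ge v k y \<Longrightarrow> val_ge v k (x + y)"
  using discrete unfolding discrete_valuation_def val_ge_def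
  by (cases "x = 0 \<or> y = 0 \<or> x + y = 0") (auto, smt (verit))

lemma val_ge_uminus [simp]: "val_ge v k (- x) \<longleftrightarrow> val_ge v k x"
  by (simp add: val_ge_def)

lemma val_ge_diff: "val_ge v k x \<Longrightarrow> val_ge v k y \<Longrightarrow> val_ge v k (x - y)"
  using val_ge_add[of k x "- y"] by simp

lemma val_ge_sum: "(\<And>i. i \<in> I \<Longrightarrow> val_ge v k (g i)) \<Longrightarrow> val_ge v k (sum g I)"
  by (induction I rule: infinite_finite_induct) (auto intro: val_ge_add)

lemma val_ge_mult: "val_ge v k x \<Longrightarrow> val_ge v l y \<Longrightarrow> val_ge v (k + l) (x * y)"
  by (auto simp: val_ge_def val_mult)

lemma val_ge_mult0: "val_ge v 0 x \<Longrightarrow> val_ge v l y \<Longrightarrow> val_ge v l (x * y)"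
  using val_ge_mult[of 0 x l y] by simp

lemma val_ge_divide: "val_ge v k x \<Longrightarrow> y \<noteq> 0 \<Longrightarrow> val_ge v (k - v y) (x / y)"
  by (auto simp: val_ge_def val_divide)

lemma val_ge_of_nat: "val_ge v 0 (of_nat k)"
  by (induction k) (auto intro: val_ge_add simp: val_ge_def[of v 0 1])

lemma val_ge_of_int: "val_ge v 0 (of_int k)"
  by (cases k) (auto intro: val_ge_of_nat simp del: of_nat_Suc)

text \<open>If the sum had larger value than \<open>x\<close>, subtracting \<open>y\<close> would
  give \<open>x\<close> a value larger than its own: the strict case of the ultrametric
  inequality.\<close>

lemma val_dominant:
  assumes "x \<noteq> 0" "val_ge v k y" "v x < k"
  shows "x + y \<noteq> 0" "v (x + y) = v x"
proof -
  have n: "\<not> val_ge v k x" using assms by (auto simp: val_ge_def)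
  show 0: "x + y \<noteq> 0"
    using n assms(2) val_ge_uminus[of k y] by (metis add_eq_0_iff2)
  have "val_ge v (v x) (x + y)"
    by (rule val_ge_add) (use assms in \<open>auto simp: val_ge_def\<close>)
  moreover have "\<not> val_ge v (v x + 1) (x + y)"
  proof
    assume "val_ge v (v x + 1) (x + y)"
    moreover have "val_ge v (v x + 1) y" using assms by (auto simp: val_ge_def)
    ultimately have "val_ge v (v x + 1) (x + y - y)" by (rule val_ge_diff)
    then show False using assms by (simp add: val_ge_def)
  qed
  ultimately show "v (x + y) = v x" using 0 by (simp add: val_ge_def)
qed

section \<open>The residue field of a discrete valuation\<close>

lemma ring_valuation_ring: "ring (sub_ring (valuation_ring v))"
proof -
  interpret R: field "ring_of_type_algebra :: 'a ring" by (rule field_from_type_algebra)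
  have "subring (valuation_ring v) ring_of_type_algebra"
    by (rule R.subringI)
      (auto simp: valuation_ring_iff intro: val_ge_add val_ge_mult0, simp add: val_ge_def)
  then show ?thesis by (rule R.subring_is_ring)
qed

lemma ideal_valuation_ideal: "ideal (valuation_ideal v) (sub_ring (valuation_ring v))"
proof -
  interpret O: ring "sub_ring (valuation_ring v)" by (rule ring_valuation_ring)
  have neg: "\<ominus>\<^bsub>sub_ring (valuation_ring v)\<^esub> a = - a" if "val_ge v 0 a" for a
    using O.minus_equality[of "- a" a] that by (simp add: valuation_ring_iff)
  show ?thesis
  proof (rule idealI[OF ring_valuation_ring])
    show "subgroup (valuation_ideal v) (add_monoid (sub_ring (valuation_ring v)))"
    proof (rule O.add.subgroupI)
      show "valuation_ideal v \<subseteq> carrier (sub_ring (valuation_ring v))"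
        by (auto simp: valuation_ring_iff valuation_ideal_iff val_ge_def)
      have "0 \<in> valuation_ideal v" by (simp add: valuation_ideal_iff)
      then show "valuation_ideal v \<noteq> {}" by blast
      show "\<ominus>\<^bsub>sub_ring (valuation_ring v)\<^esub> a \<in> valuation_ideal v" if "a \<in> valuation_ideal v" for a
      proof -
        have "val_ge v 1 a" using that by (simp add: valuation_ideal_iff)
        then show ?thesis using neg[of a] val_ge_mono[of v 1 a 0] by (simp add: valuation_ideal_iff)
      qed
    qed (auto simp: valuation_ideal_iff intro: val_ge_add)
  next
    fix a x assume "a \<in> valuation_ideal v" "x \<in> carrier (sub_ring (valuation_ring v))"
    then have "val_ge v 1 (x * a)" by (auto simp: valuation_ideal_iff valuation_ring_iff intro: val_ge_mult0)
    then show "x \<otimes>\<^bsub>sub_ring (valuation_ring v)\<^esub> a \<in> valuation_ideal v"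
      "a \<otimes>\<^bsub>sub_ring (valuation_ring v)\<^esub> x \<in> valuation_ideal v"
      by (simp_all add: valuation_ideal_iff mult.commute)
  qed
qed

text \<open>The coset is a plain translate inside the type, so classes can be compared for arbitrary
  elements, before integrality is known.\<close>

lemma residue_class_image: "residue_class v x = (\<lambda>i. i + x) ` valuation_ideal v"
  by (auto simp: residue_class_def a_r_coset_def r_coset_def)

lemma residue_class_eqI: "residue_class v x = residue_class v y" if "val_ge v 1 (x - y)"
proof -
  have "residue_class v x \<subseteq> residue_class v y" if xy: "val_ge v 1 (x - y)" for x y
  proof -
    have "i + x \<in> residue_class v y" if "i \<in> valuation_ideal v" for i
    proof -
      have "i + x = (i + (x - y)) + y" by simp
      moreover have "i + (x - y) \<in> valuation_ideal v"
        using that xy by (simp add: valuation_ideal_iff val_ge_add)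
      ultimately show ?thesis unfolding residue_class_image by (rule image_eqI)
    qed
    then show ?thesis unfolding residue_class_image[of x] by blast
  qed
  moreover have "val_ge v 1 (y - x)" using that val_ge_uminus[of 1 "x - y"] by simp
  ultimately show ?thesis using that by blast
qed

lemma residue_class_eq_zero: "residue_class v x = \<zero>\<^bsub>residue_field v\<^esub> \<longleftrightarrow> val_ge v 1 x"
proof -
  have zero: "\<zero>\<^bsub>residue_field v\<^esub> = residue_class v 0"
    by (simp add: residue_field_def FactRing_def residue_class_image)
  have "x \<in> residue_class v x"
    unfolding residue_class_image by (rule image_eqI[of _ _ 0]) (simp_all add: valuation_ideal_iff)
  then show ?thesis
    unfolding zero using residue_class_eqI[of x 0]
    by (auto simp: residue_class_image[of 0] valuation_ideal_iff)
qed

lemma residue_class_carrier: "val_ge v 0 x \<Longrightarrow> residue_class v x \<in> carrier (residue_field v)"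
  by (auto simp: residue_field_def FactRing_def A_RCOSETS_def' residue_class_def valuation_ring_iff)

text \<open>The class map is a homomorphism of additive groups, hence respects integer multiples,
  and in the valuation ring the multiple \<open>[e]\<close> is the product with
  \<open>of_int e\<close>.\<close>

lemma residue_class_int_mult:
  assumes "val_ge v 0 x"
  shows "[(e :: int)] \<cdot>\<^bsub>residue_field v\<^esub> residue_class v x = residue_class v (of_int e * x)"
proof -
  let ?O = "sub_ring (valuation_ring v)"
  interpret O: ring ?O by (rule ring_valuation_ring)
  interpret I: ideal "valuation_ideal v" ?O by (rule ideal_valuation_ideal)
  interpret h: ring_hom_ring ?O "residue_field v" "residue_class v"
    using I.rcos_ring_hom_ring unfolding residue_field_def residue_class_def[abs_def] .
  have x: "x \<in> carrier ?O" using assms by (simp add: valuation_ring_iff)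
  have nat: "[(k :: nat)] \<cdot>\<^bsub>?O\<^esub> x = of_nat k * x" for k
    by (induction k) (simp_all add: add_pow_def algebra_simps)
  have neg: "\<ominus>\<^bsub>?O\<^esub> a = - a" if "val_ge v 0 a" for a
    using O.minus_equality[of "- a" a] that by (simp add: valuation_ring_iff)
  have int: "[e] \<cdot>\<^bsub>?O\<^esub> x = of_int e * x"
    using add_pow_int_ge[of e ?O x] add_pow_int_lt[of e ?O x] assms
    by (cases "e \<ge> 0")
      (simp_all add: nat neg val_ge_mult0[OF val_ge_of_nat] val_ge_mult0[OF val_ge_of_int])
  have "residue_class v ([e] \<cdot>\<^bsub>?O\<^esub> x) = [e] \<cdot>\<^bsub>residue_field v\<^esub> residue_class v x"
    unfolding add_pow_def
    by (rule group_hom.hom_int_pow[OF h.a_group_hom]) (use x in simp)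
  then show ?thesis by (simp add: int)
qed

end

section \<open>Residues at a normal place\<close>

text \<open>The common ground of both kinds of places. The value of \<open>h0\<close> stands for
  \<eta>, so the bound \<open>- 1 - v h0\<close> used below is -\<delta>; \<open>val_of_int\<close>
  says that the residue characteristic is 0.\<close>

locale normal_valuation = valued_field v for v :: "'a::field_char_0 \<Rightarrow> int" +
  fixes D :: "'a \<Rightarrow> 'a" and h0 :: 'a
  assumes derivation: "derivation D"
    and h0: "h0 \<noteq> 0"
    and integral: "val_ge v 0 x \<Longrightarrow> val_ge v 0 (h0 * D x)"
    and normal: "\<exists>p. uniformiser v p \<and> D p \<noteq> 0 \<and> v (h0 * D p) = 0"
    and val_of_int: "k \<noteq> 0 \<Longrightarrow> v (of_int k) = 0"
begin

abbreviation dlog :: "'a \<Rightarrow> 'a" where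
  "dlog x \<equiv> h0 * (D x / x)"

text \<open>Split off the unit \<open>u = x / p powi v x\<close>. Logarithmic derivatives turn the
  product into a sum, and \<open>dlog u\<close> is integral because \<open>h0 * D u\<close> is
  integral and \<open>u\<close> is a unit.\<close>

lemma dlog_cong:
  assumes "x \<noteq> 0" "uniformiser v p"
  shows "val_ge v 0 (dlog x - of_int (v x) * dlog p)"
proof -
  have p: "p \<noteq> 0" "v p = 1" using assms(2) by (auto simp: uniformiser_def)
  define u where "u = x / p powi v x"
  have x: "x = u * p powi v x" and u: "u \<noteq> 0" using assms p by (auto simp: u_def)
  have vu: "v u = 0" using assms p by (simp add: u_def val_divide val_power_int)
  have "D x / x = D u / u + of_int (v x) * (D p / p)"
    by (subst x, subst x) (simp add: dlog_mult[OF derivation] dlog_power_int[OF derivation] u p)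
  then have "dlog x - of_int (v x) * dlog p = h0 * D u / u"
    by (simp add: algebra_simps)
  moreover have "val_ge v 0 (h0 * D u / u)"
    using val_ge_divide[OF integral u, of u] vu by (simp add: val_ge_def)
  ultimately show ?thesis by simp
qed

text \<open>The integer \<open>v x\<close> is a unit, so the main term
  \<open>of_int (v x) * dlog p\<close> has value exactly -1 and dominates the integral error of
  \<open>dlog_cong\<close>.\<close>

lemma val_dlog:
  assumes "x \<noteq> 0" "v x \<noteq> 0"
  shows "dlog x \<noteq> 0" "v (dlog x) = - 1"
proof -
  obtain p where p: "uniformiser v p" "D p \<noteq> 0" "v (h0 * D p) = 0" using normal by blast
  then have p': "p \<noteq> 0" "v p = 1" by (auto simp: uniformiser_def)
  define z where "z = of_int (v x) * dlog p"
  have dp: "dlog p \<noteq> 0" "v (dlog p) = - 1"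
    using p p' h0 val_divide[of "h0 * D p" p] by auto
  have z: "z \<noteq> 0" "v z = - 1"
    using dp assms val_mult[OF _ dp(1), of "of_int (v x)"] val_of_int[of "v x"]
    by (auto simp: z_def)
  have "dlog x = z + (dlog x - z)" by simp
  moreover have "val_ge v 0 (dlog x - z)" unfolding z_def by (rule dlog_cong) fact+
  ultimately show "dlog x \<noteq> 0" "v (dlog x) = - 1"
    using val_dominant[OF z(1), of 0 "dlog x - z"] z(2) by auto
qed

lemma val_ge_dlog: "x \<noteq> 0 \<Longrightarrow> val_ge v (- 1) (dlog x)"
  using val_dlog[of x] integral[of x] val_ge_divide[of 0 "h0 * D x" x]
  by (cases "v x = 0") (auto simp: val_ge_def)

text \<open>Rewrites residues in terms of \<open>dlog\<close>, whose pole order is known. Division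
  by zero yields zero, so both sides vanish when \<open>x\<close> or \<open>D x\<close>
  does.\<close>

lemma divide_dlog: "f * (x / D x) = (h0 * f) / dlog x"
  using h0 by simp

lemma val_ge_h0_mult: "val_ge v (- 1 - v h0) f \<Longrightarrow> val_ge v (- 1) (h0 * f)"
  using h0 by (auto simp: val_ge_def val_mult)

lemma val_ge_residue:
  assumes "val_ge v (- 1 - v h0) f" "x \<noteq> 0" "v x \<noteq> 0"
  shows "D x \<noteq> 0" "val_ge v 0 (f * (x / D x))"
proof -
  note dl = val_dlog[OF assms(2,3)]
  show "D x \<noteq> 0" using dl by auto
  have "val_ge v (- 1) (h0 * f)" by (rule val_ge_h0_mult) fact
  then show "val_ge v 0 (f * (x / D x))"
    unfolding divide_dlog using val_ge_divide[of "- 1" "h0 * f" "dlog x"] dl by simp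
qed

text \<open>Over the common denominator \<open>dlog p * dlog x\<close> of value -2, the numerator is
  an integral element times \<open>h0 * f\<close>, of value at least -1; the quotient has value at
  least 1. A second uniformiser for \<open>x\<close> gives independence of the choice, a general
  \<open>x\<close> the formula with the factor \<open>e\<close>.\<close>

lemma residue_cong:
  assumes "val_ge v (- 1 - v h0) f" "uniformiser v p" "x \<noteq> 0" "v x \<noteq> 0"
  shows "val_ge v 1 (f * (p / D p) - of_int (v x) * (f * (x / D x)))"
proof -
  have p: "p \<noteq> 0" "v p \<noteq> 0" using assms(2) by (auto simp: uniformiser_def)
  note dx = val_dlog[OF assms(3,4)] and dp = val_dlog[OF p]
  have "val_ge v (- 1) (h0 * f)" by (rule val_ge_h0_mult) fact
  with dlog_cong[OF assms(3,2)]
  have "val_ge v (- 1) ((dlog x - of_int (v x) * dlog p) * (h0 * f))"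
    by (rule val_ge_mult0)
  from val_ge_divide[OF this, of "dlog p * dlog x"]
  have "val_ge v 1 ((dlog x - of_int (v x) * dlog p) * (h0 * f) / (dlog p * dlog x))"
    using dx dp val_mult[OF dp(1) dx(1)] by simp
  moreover have "(dlog x - of_int (v x) * dlog p) * (h0 * f) / (dlog p * dlog x)
      = h0 * f / dlog p - of_int (v x) * (h0 * f / dlog x)"
  proof -
    have "(a - e * b) * g / (b * a) = g / b - e * (g / a)" if "a \<noteq> 0" "b \<noteq> 0" for a b e g :: 'a
      using that by (simp add: field_simps)
    from this[OF dx(1) dp(1)] show ?thesis .
  qed
  ultimately show ?thesis unfolding divide_dlog by simp
qed

text \<open>The value of \<open>f * (p / D p)\<close> is exactly \<open>v h0 + v f + 1\<close>,
  since \<open>dlog p\<close> has value -1.\<close>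

lemma residue_eq_zero_iff:
  assumes "val_ge v (- 1 - v h0) f" "f \<noteq> 0" "uniformiser v p"
  shows "val_ge v 1 (f * (p / D p)) \<longleftrightarrow> v f \<noteq> - 1 - v h0"
proof -
  have p: "p \<noteq> 0" "v p \<noteq> 0" using assms(3) by (auto simp: uniformiser_def)
  note dp = val_dlog[OF p]
  have "v (f * (p / D p)) = v h0 + v f + 1" "f * (p / D p) \<noteq> 0"
    unfolding divide_dlog using dp h0 assms(2) val_divide[OF _ dp(1), of "h0 * f"] val_mult[of h0 f]
    by auto
  then show ?thesis using assms(1,2) by (auto simp: val_ge_def)
qed

text \<open>
  A pole of \<open>w\<close> would give \<open>D w\<close> a pole of order at least \<open>\<delta> + 1\<close>, which neither \<open>f\<close> nor the
  logarithmic derivatives can have; so \<open>w\<close> is integral and does not contribute to the residue.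
\<close>
lemma residue_representation:
  assumes "val_ge v (- 1 - v h0) f" "uniformiser v p"
    and f: "f = D w + (\<Sum>i\<in>I. c i * (D (u i) / u i))"
    and c: "\<And>i. i \<in> I \<Longrightarrow> val_ge v 0 (c i)" and u: "\<And>i. i \<in> I \<Longrightarrow> u i \<noteq> 0"
  shows "val_ge v 1 (f * (p / D p) - (\<Sum>i\<in>I. c i * of_int (v (u i))))"
proof -
  have p: "p \<noteq> 0" "v p \<noteq> 0" using assms(2) by (auto simp: uniformiser_def)
  note dp = val_dlog[OF p]
  have hf: "h0 * f = h0 * D w + (\<Sum>i\<in>I. c i * dlog (u i))"
    unfolding f by (simp add: distrib_left sum_distrib_left mult.left_commute)
  have "val_ge v 0 w"
  proof (rule ccontr)
    assume "\<not> val_ge v 0 w"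
    then have w: "w \<noteq> 0" "v w < 0" by (auto simp: val_ge_def)
    have "val_ge v (- 1) (h0 * f)" by (rule val_ge_h0_mult) fact
    moreover have "val_ge v (- 1) (\<Sum>i\<in>I. c i * dlog (u i))"
      by (intro val_ge_sum val_ge_mult0 val_ge_dlog c u)
    ultimately have "val_ge v (- 1) (h0 * f - (\<Sum>i\<in>I. c i * dlog (u i)))" by (rule val_ge_diff)
    then have "val_ge v (- 1) (dlog w * w)" unfolding hf using w by simp
    moreover have "dlog w \<noteq> 0" "v (dlog w) = - 1" using val_dlog[of w] w by auto
    ultimately show False using w val_mult[of "dlog w" w] by (simp add: val_ge_def)
  qed
  then have "val_ge v 0 (h0 * D w)" by (rule integral)
  \<comment> \<open>Each \<open>dlog (u i)\<close> is replaced by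
    \<open>of_int (v (u i)) * dlog p\<close> at the cost of an integral error; so
    \<open>h0 * f\<close> is a constant multiple of \<open>dlog p\<close> modulo integral
    elements.\<close>
  moreover have "val_ge v 0 (\<Sum>i\<in>I. c i * (dlog (u i) - of_int (v (u i)) * dlog p))"
    by (intro val_ge_sum val_ge_mult0 dlog_cong assms)
  ultimately have "val_ge v 0 (h0 * D w + (\<Sum>i\<in>I. c i * (dlog (u i) - of_int (v (u i)) * dlog p)))"
    by (rule val_ge_add)
  also have "h0 * D w + (\<Sum>i\<in>I. c i * (dlog (u i) - of_int (v (u i)) * dlog p))
      = h0 * f - (\<Sum>i\<in>I. c i * of_int (v (u i))) * dlog p"
  proof -
    have "(\<Sum>i\<in>I. c i * (g i - e i * b)) = (\<Sum>i\<in>I. c i * g i) - (\<Sum>i\<in>I. c i * e i) * b"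
      for g e and b :: 'a
      by (simp add: right_diff_distrib sum_subtractf sum_distrib_right mult.assoc)
    from this[of "\<lambda>i. dlog (u i)" "\<lambda>i. of_int (v (u i))" "dlog p"] show ?thesis
      unfolding hf by simp
  qed
  \<comment> \<open>Division by \<open>dlog p\<close>, of value -1, raises the bound from 0 to
    1.\<close>
  finally have "val_ge v 1 ((h0 * f - (\<Sum>i\<in>I. c i * of_int (v (u i))) * dlog p) / dlog p)"
    using val_ge_divide[of 0 _ "dlog p"] dp by fastforce
  also have "(h0 * f - (\<Sum>i\<in>I. c i * of_int (v (u i))) * dlog p) / dlog p
      = f * (p / D p) - (\<Sum>i\<in>I. c i * of_int (v (u i)))"
  proof -
    have "(g - s * b) / b = g / b - s" if "b \<noteq> 0" for g s b :: 'a
      using that by (simp add: field_simps)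
    from this[OF dp(1)] show ?thesis unfolding divide_dlog .
  qed
  finally show ?thesis .
qed

end

text \<open>A nonzero integer and its inverse both lie in \<open>K\<close>, hence both are
  integral.\<close>

lemma (in valued_field) val_of_int_eq_0:
  assumes "subfield K ring_of_type_algebra" "K \<subseteq> valuation_ring v" "of_int k \<noteq> (0 :: 'a)"
  shows "v (of_int k) = 0"
proof -
  have "of_int k \<in> K" "inverse (of_int k) \<in> K"
    using subfield_of_int[OF assms(1)] subfieldD(6)[OF assms(1)] by blast+
  then have "val_ge v 0 (of_int k)" "val_ge v 0 (inverse (of_int k))"
    using assms(2) by (auto simp: valuation_ring_iff)
  then show ?thesis using assms(3) val_inverse[of "of_int k"] by (simp add: val_ge_def)
qed

section \<open>Height-one primes\<close>

lemma normal_valuation_prime: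
  fixes B :: "'a::field_char_0 set"
  assumes D: "derivation D" and P: "height_one_prime B P" "prime_valuation B P v"
    and normal: "normal_place D B v"
    and K: "subfield K ring_of_type_algebra" "K \<subseteq> B"
  shows "K \<subseteq> valuation_ring v"
    and "\<exists>h0. normal_valuation v D h0 \<and> eta D B v = ereal (of_int (v h0))"
proof -
  interpret valued_field v
    using P(2) by unfold_locales (simp add: prime_valuation_def)
  have ring: "valuation_ring v = {a / b |a b. a \<in> B \<and> b \<in> B - P}"
    using P(2) by (simp add: prime_valuation_def)
  interpret P: primeideal P "sub_ring B" using P(1) by (simp add: height_one_prime_def)
  have one: "1 \<in> B" using subfieldD(2)[OF K(1)] K(2) by blast
  have one': "1 \<notin> P" using P.one_imp_carrier P.I_notcarr by auto
  have zero: "0 \<in> P" using additive_subgroup.zero_closed[OF P.additive_subgroup_axioms] by simp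
  have "a / 1 \<in> valuation_ring v" if "a \<in> B" for a
    unfolding ring using that one one' by blast
  then have B: "val_ge v 0 a" if "a \<in> B" for a
    using that by (simp add: valuation_ring_iff)
  then show KO: "K \<subseteq> valuation_ring v" using K(2) by (auto simp: valuation_ring_iff)
  have unit: "b \<noteq> 0" "v b = 0" if "b \<in> B - P" for b
  proof -
    show 0: "b \<noteq> 0" using that zero by blast
    \<comment> \<open>Denominators of the localisation become units there: both \<open>b\<close> and
      its inverse are integral.\<close>
    have "1 / b \<in> valuation_ring v" unfolding ring using that one by blast
    with B[of b] that 0 val_inverse[of b] show "v b = 0"
      by (simp add: valuation_ring_iff val_ge_def divide_inverse)
  qed
  obtain h0 p where h0: "h0 \<noteq> 0" "ext_val v h0 = eta D B v" and p: "uniformiser v p"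
    "ext_val v (h0 * D p) = 0"
    using normal by (auto simp: normal_place_def)
  have eta: "eta D B v = ereal (of_int (v h0))" using h0 by (simp add: ext_val_def)
  \<comment> \<open>The supremum in \<open>eta\<close> bounds the pole order of every
    \<open>D a\<close> by \<open>v h0\<close>, which the factor \<open>h0\<close>
    compensates.\<close>
  have DB: "val_ge v 0 (h0 * D a)" if "a \<in> B" for a
  proof (cases "a = 0 \<or> D a = 0")
    case False
    then have "- ext_val v (D a) \<le> eta D B v"
      unfolding eta_def using that by (intro max.coboundedI2 SUP_upper) auto
    then have "- v (D a) \<le> v h0" using False by (simp add: eta ext_val_def flip: of_int_minus)
    then show ?thesis using False h0(1) by (simp add: val_ge_def val_mult)
  qed (auto simp: derivation_0[OF D])
  have "normal_valuation v D h0"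
  proof unfold_locales
    \<comment> \<open>Write \<open>x\<close> as a fraction with unit denominator; the quotient rule
      carries integrality of \<open>h0 * D\<close> from \<open>B\<close> to its
      localisation.\<close>
    fix x assume "val_ge v 0 x"
    then obtain a b where x: "x = a / b" "a \<in> B" "b \<in> B - P"
      using ring by (auto simp flip: valuation_ring_iff)
    note b = unit[OF x(3)]
    have "h0 * D x = h0 * D a / b - a * (h0 * D b) / (b * b)"
      unfolding x(1) derivation_divide[OF D] using b by (simp add: field_simps)
    moreover have "val_ge v 0 (h0 * D a / b)"
      using val_ge_divide[OF DB[OF x(2)] b(1)] b by simp
    moreover have "val_ge v 0 (a * (h0 * D b) / (b * b))"
      using val_ge_divide[OF val_ge_mult0[OF B[OF x(2)] DB[of b]], of "b * b"] b x(3)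
      by (simp add: val_mult)
    ultimately show "val_ge v 0 (h0 * D x)" by (simp add: val_ge_diff)
  next
    have "h0 * D p \<noteq> 0" "v (h0 * D p) = 0"
      using p(2) by (auto simp: ext_val_def split: if_splits)
    then show "\<exists>p. uniformiser v p \<and> D p \<noteq> 0 \<and> v (h0 * D p) = 0" using p(1) by auto
  qed (use D h0 val_of_int_eq_0[OF K(1) KO] in auto)
  with eta show "\<exists>h0. normal_valuation v D h0 \<and> eta D B v = ereal (of_int (v h0))" by blast
qed

section \<open>The place at infinity\<close>

lemma coeffs_subset_iff:
  assumes "0 \<in> K"
  shows "set (coeffs p) \<subseteq> K \<longleftrightarrow> (\<forall>i. Polynomial.coeff p i \<in> K)"
proof -
  have "set (coeffs p) \<subseteq> K \<longleftrightarrow> range (Polynomial.coeff p) \<subseteq> K"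
    using assms by (simp add: range_coeff)
  then show ?thesis by auto
qed

text \<open>Concrete form of \<open>K(x)\<close>: a degree valuation is prescribed only on such
  quotients. The denominator is nonzero as a polynomial; that its value at \<open>x\<close> is
  nonzero is proved separately.\<close>

definition poly_quotients :: "'a::field set \<Rightarrow> 'a \<Rightarrow> 'a set" where
  "poly_quotients K x =
     {poly a x / poly b x |a b. set (coeffs a) \<subseteq> K \<and> set (coeffs b) \<subseteq> K \<and> b \<noteq> 0}"

lemma poly_quotientsI:
  "set (coeffs a) \<subseteq> K \<Longrightarrow> set (coeffs b) \<subseteq> K \<Longrightarrow> b \<noteq> 0 \<Longrightarrow>
     poly a x / poly b x \<in> poly_quotients K x"
  unfolding poly_quotients_def by blast

context
  fixes K :: "'a::field set" and x :: 'a and v :: "'a \<Rightarrow> int"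
  assumes K: "subfield K ring_of_type_algebra" and v: "degree_valuation K x v"
begin

private lemma coeffs_iff: "set (coeffs p) \<subseteq> K \<longleftrightarrow> (\<forall>i. Polynomial.coeff p i \<in> K)"
  by (rule coeffs_subset_iff) (rule subfieldD(1)[OF K])

lemma coeffs_mult: "set (coeffs p) \<subseteq> K \<Longrightarrow> set (coeffs q) \<subseteq> K \<Longrightarrow> set (coeffs (p * q)) \<subseteq> K"
  unfolding coeffs_iff coeff_mult by (auto intro!: subfield_sum[OF K] subfieldD(4)[OF K])

lemma coeffs_add: "set (coeffs p) \<subseteq> K \<Longrightarrow> set (coeffs q) \<subseteq> K \<Longrightarrow> set (coeffs (p + q)) \<subseteq> K"
  unfolding coeffs_iff by (auto intro: subfieldD(3)[OF K])

lemma coeffs_uminus: "set (coeffs p) \<subseteq> K \<Longrightarrow> set (coeffs (- p)) \<subseteq> K"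
  unfolding coeffs_iff by (auto intro: subfieldD(5)[OF K])

lemma coeffs_const: "k \<in> K \<Longrightarrow> set (coeffs [:k:]) \<subseteq> K"
  using subfieldD(1)[OF K] unfolding coeffs_iff by (simp add: coeff_pCons split: nat.split)

lemma coeffs_1: "set (coeffs (1 :: 'a poly)) \<subseteq> K"
  using subfieldD(2)[OF K] by simp

lemma coeffs_X: "set (coeffs [:0, 1:]) \<subseteq> K"
  using subfieldD(1,2)[OF K] unfolding coeffs_iff by (simp add: coeff_pCons split: nat.split)

lemma degree_valuation_quotient:
  "set (coeffs a) \<subseteq> K \<Longrightarrow> set (coeffs b) \<subseteq> K \<Longrightarrow> a \<noteq> 0 \<Longrightarrow> b \<noteq> 0 \<Longrightarrow>
     v (poly a x / poly b x) = int (Polynomial.degree b) - int (Polynomial.degree a)"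
  using v unfolding degree_valuation_def by blast

text \<open>
  An algebraic relation \<open>a(x) = 0\<close> would give the value \<open>v 0\<close> computed from \<open>a(x) / 1\<close> and from
  \<open>a(x) / x\<close> two different degrees.
\<close>
lemma degree_valuation_poly_nonzero:
  assumes "set (coeffs a) \<subseteq> K" "a \<noteq> 0"
  shows "poly a x \<noteq> 0"
proof
  assume "poly a x = 0"
  then show False
    using degree_valuation_quotient[OF assms(1) coeffs_1 assms(2)]
      degree_valuation_quotient[OF assms(1) coeffs_X assms(2)] by simp
qed

lemma subfield_poly_quotients: "subfield (poly_quotients K x) ring_of_type_algebra"
  unfolding subfield_type_iff
proof (intro conjI ballI)
  show "1 \<in> poly_quotients K x"
    using poly_quotientsI[OF coeffs_1 coeffs_1, of x] by simp
  fix r assume "r \<in> poly_quotients K x"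
  then obtain a b where r: "r = poly a x / poly b x" and ab: "set (coeffs a) \<subseteq> K" "set (coeffs b) \<subseteq> K" "b \<noteq> 0"
    unfolding poly_quotients_def by blast
  show "- r \<in> poly_quotients K x"
    using poly_quotientsI[OF coeffs_uminus[OF ab(1)] ab(2,3), of x] by (simp add: r)
  show "inverse r \<in> poly_quotients K x"
  proof (cases "a = 0")
    \<comment> \<open>Here \<open>r = 0\<close>, and \<open>inverse 0 = 0\<close> is the same
      quotient.\<close>
    case True
    then show ?thesis using poly_quotientsI[OF ab, of x] by (simp add: r)
  next
    case False
    then show ?thesis using poly_quotientsI[OF ab(2,1) False, of x] by (simp add: r)
  qed
  fix s assume "s \<in> poly_quotients K x"
  then obtain c d where s: "s = poly c x / poly d x" and cd: "set (coeffs c) \<subseteq> K" "set (coeffs d) \<subseteq> K" "d \<noteq> 0"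
    unfolding poly_quotients_def by blast
  have bd: "set (coeffs (b * d)) \<subseteq> K" "b * d \<noteq> 0" using ab cd coeffs_mult by auto
  have "r + s = poly (a * d + c * b) x / poly (b * d) x"
    using degree_valuation_poly_nonzero ab cd by (simp add: r s field_simps)
  moreover have "set (coeffs (a * d + c * b)) \<subseteq> K" using ab cd by (intro coeffs_add coeffs_mult)
  ultimately show "r + s \<in> poly_quotients K x" using poly_quotientsI[OF _ bd] by metis
  have "r * s = poly (a * c) x / poly (b * d) x" by (simp add: r s)
  moreover have "set (coeffs (a * c)) \<subseteq> K" using ab cd by (intro coeffs_mult)
  ultimately show "r * s \<in> poly_quotients K x" using poly_quotientsI[OF _ bd] by metis
qed

lemma adjoin_subset_poly_quotients: "adjoin K {x} \<subseteq> poly_quotients K x"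
proof (rule generate_field_subset[OF subfield_poly_quotients], rule subsetI)
  fix z assume "z \<in> K \<union> {x}"
  then have "\<exists>p. set (coeffs p) \<subseteq> K \<and> z = poly p x"
    using coeffs_const[of z] coeffs_X
    by (elim UnE) (rule exI[of _ "[:z:]"], simp, rule exI[of _ "[:0, 1:]"], simp)
  then obtain p where p: "set (coeffs p) \<subseteq> K" "z = poly p x" by blast
  then show "z \<in> poly_quotients K x" using poly_quotientsI[OF p(1) coeffs_1, of x] by simp
qed

lemma degree_valuation_const: "k \<in> K \<Longrightarrow> k \<noteq> 0 \<Longrightarrow> v k = 0"
  using degree_valuation_quotient[OF coeffs_const coeffs_1, of k] by simp

context
  assumes univ: "poly_quotients K x = UNIV"
begin

private lemma quotientE:
  assumes "z \<noteq> 0"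
  obtains a b where "z = poly a x / poly b x" "set (coeffs a) \<subseteq> K" "set (coeffs b) \<subseteq> K" "a \<noteq> 0" "b \<noteq> 0"
proof -
  have "z \<in> poly_quotients K x" by (simp add: univ)
  then show ?thesis using assms that unfolding poly_quotients_def by fastforce
qed

text \<open>Degrees add under products, and over a common denominator the numerator of a sum has at
  most the larger degree. The uniformiser is \<open>1 / x\<close>.\<close>

lemma discrete_degree_valuation: "discrete_valuation v"
  unfolding discrete_valuation_def
proof (intro conjI allI impI)
  have "v (poly 1 x / poly [:0, 1:] x) = 1"
    using degree_valuation_quotient[OF coeffs_1 coeffs_X] by simp
  moreover have "x \<noteq> 0" using degree_valuation_poly_nonzero[OF coeffs_X] by simp
  ultimately show "\<exists>p. uniformiser v p"
    unfolding uniformiser_def by (intro exI[of _ "1 / x"]) simp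
next
  fix r s :: 'a assume "r \<noteq> 0" "s \<noteq> 0"
  obtain a b where r: "r = poly a x / poly b x" and ab: "set (coeffs a) \<subseteq> K" "set (coeffs b) \<subseteq> K" "a \<noteq> 0" "b \<noteq> 0"
    using quotientE[OF \<open>r \<noteq> 0\<close>] .
  obtain c d where s: "s = poly c x / poly d x" and cd: "set (coeffs c) \<subseteq> K" "set (coeffs d) \<subseteq> K" "c \<noteq> 0" "d \<noteq> 0"
    using quotientE[OF \<open>s \<noteq> 0\<close>] .
  have bd: "set (coeffs (b * d)) \<subseteq> K" "b * d \<noteq> 0" using ab cd coeffs_mult by auto
  have vr: "v r = int (Polynomial.degree b) - int (Polynomial.degree a)"
    unfolding r by (rule degree_valuation_quotient) fact+
  have vs: "v s = int (Polynomial.degree d) - int (Polynomial.degree c)"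
    unfolding s by (rule degree_valuation_quotient) fact+
  have "r * s = poly (a * c) x / poly (b * d) x" by (simp add: r s)
  moreover have "set (coeffs (a * c)) \<subseteq> K" using ab cd by (intro coeffs_mult)
  ultimately show "v (r * s) = v r + v s"
    using degree_valuation_quotient[of "a * c" "b * d"] ab cd bd
    by (simp add: vr vs degree_mult_eq)
  assume "r + s \<noteq> 0"
  define e where "e = a * d + c * b"
  have rs: "r + s = poly e x / poly (b * d) x"
    using degree_valuation_poly_nonzero ab cd by (simp add: r s e_def field_simps)
  have e: "set (coeffs e) \<subseteq> K" unfolding e_def using ab cd by (intro coeffs_add coeffs_mult)
  have "e \<noteq> 0" using \<open>r + s \<noteq> 0\<close> rs by auto
  have "v (r + s) = int (Polynomial.degree (b * d)) - int (Polynomial.degree e)"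
    unfolding rs by (rule degree_valuation_quotient) fact+
  moreover have "Polynomial.degree e \<le> max (Polynomial.degree (a * d)) (Polynomial.degree (c * b))"
    unfolding e_def by (rule degree_add_le_max)
  ultimately show "min (v r) (v s) \<le> v (r + s)"
    using ab cd by (simp add: vr vs degree_mult_eq)
qed

end

end

text \<open>
  The valuation ring at infinity is a localisation of \<open>K[1/x]\<close>, and \<open>D (1/x) = - w (1 + 1/x\<^sup>2)\<close>.
\<close>
lemma normal_valuation_infinity:
  fixes K :: "'a::field_char_0 set"
  assumes D: "derivation D" and K: "subfield K ring_of_type_algebra" "D ` K \<subseteq> K"
    and v: "degree_valuation K x v" and univ: "adjoin K {x} = UNIV"
    and w: "w \<in> K" "w \<noteq> 0" "D x = w * (1 + x\<^sup>2)"
  shows "K \<subseteq> valuation_ring v" and "normal_valuation v D 1" and "eta D (valuation_ring v) v = 0"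
proof -
  have quot: "poly_quotients K x = UNIV"
    using adjoin_subset_poly_quotients[OF K(1) v] univ by auto
  interpret valued_field v
    by unfold_locales (rule discrete_degree_valuation[OF K(1) v quot])
  have valK: "val_ge v 0 k" if "k \<in> K" for k
    using degree_valuation_const[OF K(1) v that] by (auto simp: val_ge_def)
  then show KO: "K \<subseteq> valuation_ring v" by (auto simp: valuation_ring_iff)
  have x0: "x \<noteq> 0"
    using degree_valuation_poly_nonzero[OF K(1) v coeffs_X[OF K(1) v]] by simp
  have vx: "v x = - 1"
    using degree_valuation_quotient[OF K(1) v coeffs_X[OF K(1) v] coeffs_1[OF K(1) v]] by simp
  define s where "s = inverse x"
  have s: "s \<noteq> 0" "v s = 1" using x0 vx by (auto simp: s_def val_inverse)
  have Ds: "D s = - (w * (1 + s * s))"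
    unfolding s_def derivation_inverse[OF D] w(3) using x0
    by (simp add: field_simps power2_eq_square)
  \<comment> \<open>The square of \<open>s\<close> has value 2, so 1 dominates. As nonzero elements
    of \<open>K\<close> have value 0, \<open>D s\<close> is a unit: normality holds with
    \<open>h0 = 1\<close>.\<close>
  have unit: "1 + s * s \<noteq> 0" "v (1 + s * s) = 0"
    using val_dominant[of 1 1 "s * s"] s by (auto simp: val_ge_def val_mult)
  have vDs: "D s \<noteq> 0" "v (D s) = 0"
    using unit w degree_valuation_const[OF K(1) v w(1,2)] by (auto simp: Ds val_mult)
  \<comment> \<open>Integral elements with integral derivative form a ring; it contains
    \<open>K\<close> and \<open>s\<close>, hence all of \<open>K[s]\<close>.\<close>
  define S where "S = {z. val_ge v 0 z \<and> val_ge v 0 (D z)}"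
  have S_mult: "a * b \<in> S" if "a \<in> S" "b \<in> S" for a b
    using that unfolding S_def
    by (auto simp: derivation_mult[OF D] mult.commute[of "D a"] intro!: val_ge_add val_ge_mult0)
  have S_add: "a + b \<in> S" if "a \<in> S" "b \<in> S" for a b
    using that unfolding S_def by (auto simp: derivation_add[OF D] intro: val_ge_add)
  have S_K: "k \<in> S" if "k \<in> K" for k
    using that K(2) valK unfolding S_def by blast
  have S_0: "0 \<in> S" and S_1: "1 \<in> S" by (auto intro: S_K subfieldD[OF K(1)])
  have S_sum: "sum g I \<in> S" if "\<And>i. i \<in> I \<Longrightarrow> g i \<in> S" for g and I :: "nat set"
    using that by (induction I rule: infinite_finite_induct) (auto intro: S_0 S_add)
  have "s \<in> S" using s vDs by (simp add: S_def val_ge_def)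
  then have S_power: "s ^ i \<in> S" for i
    by (induction i) (auto intro: S_1 S_mult)
  have S_poly: "poly p x * s ^ m \<in> S" if "set (coeffs p) \<subseteq> K" "Polynomial.degree p \<le> m" for p m
  proof -
    \<comment> \<open>Multiplication by \<open>s ^ m\<close> turns \<open>x ^ i\<close> into
      \<open>s ^ (m - i)\<close>, so a polynomial in \<open>x\<close> of degree at most
      \<open>m\<close> becomes one in \<open>s\<close>.\<close>
    have "poly p x * s ^ m = (\<Sum>i\<le>Polynomial.degree p. Polynomial.coeff p i * s ^ (m - i))"
      unfolding poly_altdef sum_distrib_right
    proof (rule sum.cong)
      fix i assume "i \<in> {..Polynomial.degree p}"
      then have "m = i + (m - i)" using that(2) by auto
      then have "s ^ m = s ^ i * s ^ (m - i)" by (metis power_add)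
      then show "Polynomial.coeff p i * x ^ i * s ^ m = Polynomial.coeff p i * s ^ (m - i)"
        using x0 by (simp add: s_def power_inverse)
    qed simp
    also have "\<dots> \<in> S"
      using that(1) unfolding coeffs_subset_iff[OF subfieldD(1)[OF K(1)]]
      by (intro S_sum S_mult S_power S_K) blast
    finally show ?thesis .
  qed
  have integral: "val_ge v 0 (D z)" if z: "val_ge v 0 z" for z
  proof (cases "z = 0")
    case False
    have "z \<in> poly_quotients K x" by (simp add: quot)
    then obtain a b where ab: "z = poly a x / poly b x" "set (coeffs a) \<subseteq> K" "set (coeffs b) \<subseteq> K" "b \<noteq> 0"
      unfolding poly_quotients_def by blast
    with False have "a \<noteq> 0" by auto
    \<comment> \<open>Integrality of \<open>z\<close> means that the numerator has degree at most
      \<open>m\<close>. Scaling both parts by \<open>s ^ m\<close> puts them into \<open>S\<close>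
      and makes the denominator a unit.\<close>
    define m where "m = Polynomial.degree b"
    have deg: "Polynomial.degree a \<le> m"
      using z False degree_valuation_quotient[OF K(1) v ab(2,3) \<open>a \<noteq> 0\<close> ab(4)]
      by (simp add: val_ge_def ab(1) m_def)
    define a' b' where "a' = poly a x * s ^ m" and "b' = poly b x * s ^ m"
    have S: "a' \<in> S" "b' \<in> S" unfolding a'_def b'_def using ab deg by (auto intro: S_poly simp: m_def)
    have pb: "poly b x \<noteq> 0" by (rule degree_valuation_poly_nonzero[OF K(1) v]) fact+
    have "v (poly b x) = - int m"
      using degree_valuation_quotient[OF K(1) v ab(3) coeffs_1[OF K(1) v] ab(4)] by (simp add: m_def)
    then have b': "b' \<noteq> 0" "v b' = 0" using pb s by (auto simp: b'_def val_mult val_power)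
    have z': "z = a' / b'" using s by (simp add: ab(1) a'_def b'_def)
    have "val_ge v 0 (D a' / b')"
      using S(1) val_ge_divide[of 0 "D a'" b'] b' by (simp add: S_def)
    moreover have "val_ge v 0 (a' * D b' / (b' * b'))"
      using S val_ge_divide[OF val_ge_mult0[of a' 0 "D b'"], of "b' * b'"] b' by (simp add: S_def val_mult)
    ultimately show ?thesis unfolding z' derivation_divide[OF D] by (rule val_ge_diff)
  qed (simp add: derivation_0[OF D])
  show "normal_valuation v D 1"
  proof unfold_locales
    show "\<exists>p. uniformiser v p \<and> D p \<noteq> 0 \<and> v (1 * D p) = 0"
      using s vDs by (intro exI[of _ s]) (simp add: uniformiser_def)
  qed (use D integral val_of_int_eq_0[OF K(1) KO] in auto)
  \<comment> \<open>Derivatives of integral elements have no poles, so the maximum defining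
    \<open>eta\<close> is attained by 0.\<close>
  have "- ext_val v (D z) \<le> 0" if "val_ge v 0 z" for z
    using integral[OF that] by (auto simp: val_ge_def ext_val_def)
  then have "(SUP z \<in> valuation_ring v - {0}. - ext_val v (D z)) \<le> 0"
    by (intro SUP_least) (auto simp: valuation_ring_iff)
  then show "eta D (valuation_ring v) v = 0" unfolding eta_def by (rule max.absorb1)
qed

section \<open>Closure of the tower under the derivation\<close>

context differential_tower
begin

lemma base_field_closed: "z \<in> base_field F t j \<Longrightarrow> D z \<in> base_field F t j"
  unfolding base_field_def
proof (rule derivation_closed_generate_field[OF D_derivation])
  fix z assume "z \<in> F \<union> t ` {1..j}"
  then show "D z \<in> adjoin F (t ` {1..j})"
  proof
    assume "z \<in> F"
    then have "D z \<in> F" using D_F by blast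
    then show ?thesis by (auto intro: generate_field.incl)
  next
    assume "z \<in> t ` {1..j}"
    then obtain i where i: "i \<in> {1..j}" "z = t i" by blast
    then have "base_field F t i \<subseteq> adjoin F (t ` {1..j})"
      unfolding base_field_def
      by (intro generate_field_subset[OF subfield_generate_field] order_trans[OF _ subset_generate_field]) auto
    then show ?thesis using D_t_lower i by blast
  qed
qed

lemma radical_field_closed:
  "z \<in> adjoin (base_field F t j) {y} \<Longrightarrow> D z \<in> adjoin (base_field F t j) {y}"
proof (rule derivation_closed_generate_field[OF D_derivation])
  let ?K = "adjoin (base_field F t j) {y}"
  note K = subfieldD[OF subfield_generate_field[of "base_field F t j \<union> {y}"]]
  have sub: "base_field F t j \<union> {y} \<subseteq> ?K" by (rule subset_generate_field)
  have "base_ring F t j \<subseteq> base_field F t j"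
  proof
    fix z assume "z \<in> base_ring F t j"
    then show "z \<in> base_field F t j"
      unfolding base_ring_def base_field_def
      by induction (auto intro: subfieldD[OF subfield_generate_field] generate_field.incl
          simp del: One_nat_def)
  qed
  then have q: "D q \<in> ?K" using q_in base_field_closed sub by blast
  have "D y \<in> ?K"
  proof (cases "y = 0")
    case False
    \<comment> \<open>Differentiating \<open>y ^ m = q\<close> determines \<open>D y\<close>; in
      characteristic 0 its coefficient is nonzero.\<close>
    have "of_nat m * y ^ (m - 1) * D y = D q"
      using y_power derivation_power[OF D_derivation, of y m] by simp
    moreover have nz: "of_nat m * y ^ (m - 1) \<noteq> 0" using False m_pos by simp
    ultimately have "D y = D q / (of_nat m * y ^ (m - 1))" by (simp add: field_simps)
    moreover have "of_nat m * y ^ (m - 1) \<in> ?K"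
      using sub by (intro K subfield_of_nat subfield_power subfield_generate_field) auto
    ultimately show ?thesis using q K(8) by simp
  qed (simp add: derivation_0[OF D_derivation] subfieldD(1)[OF subfield_generate_field])
  then show "D z \<in> ?K" if "z \<in> base_field F t j \<union> {y}" for z
    using that base_field_closed sub by auto
qed

lemma upper_field_closed:
  assumes "i \<le> n"
  shows "z \<in> upper_field F t j y i \<Longrightarrow> D z \<in> upper_field F t j y i"
  unfolding upper_field_def
proof (rule derivation_closed_generate_field[OF D_derivation])
  let ?K = "adjoin (base_field F t j) {y}"
  fix z assume "z \<in> ?K \<union> t ` {j+1..i}"
  then show "D z \<in> adjoin ?K (t ` {j+1..i})"
  proof
    assume "z \<in> ?K"
    then show ?thesis using radical_field_closed by (auto intro: generate_field.incl)
  next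
    assume "z \<in> t ` {j+1..i}"
    then obtain k where k: "k \<in> {j+1..i}" "z = t k" by blast
    then have "upper_field F t j y k \<subseteq> adjoin ?K (t ` {j+1..i})"
      unfolding upper_field_def
      by (intro generate_field_subset[OF subfield_generate_field] order_trans[OF _ subset_generate_field]) auto
    moreover have "D (t k) \<in> upper_field F t j y k" using D_t_upper k assms by auto
    ultimately show ?thesis using k by blast
  qed
qed

text \<open>For \<open>i = n - 1\<close> this is the coefficient field at infinity, which
  \<open>D\<close> must preserve; the added constants have derivative zero.\<close>

lemma const_upper_field_closed:
  assumes "i \<le> n"
  shows "D ` adjoin Fbar (upper_field F t j y i) \<subseteq> adjoin Fbar (upper_field F t j y i)"
proof (rule image_subsetI, rule derivation_closed_generate_field[OF D_derivation])
  let ?K = "adjoin Fbar (upper_field F t j y i)"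
  show "D z \<in> ?K" if "z \<in> Fbar \<union> upper_field F t j y i" for z
    using that
  proof
    assume "z \<in> Fbar"
    then show ?thesis using D_Fbar subfieldD(1)[OF subfield_generate_field] by simp
  next
    assume "z \<in> upper_field F t j y i"
    then show ?thesis using upper_field_closed[OF assms] by (auto intro: generate_field.incl)
  qed
qed

lemma adjoin_top_variable:
  assumes "j < n"
  shows "adjoin (adjoin Fbar (upper_field F t j y (n - 1))) {t n} = UNIV"
proof -
  let ?E = "upper_field F t j y (n - 1)"
  let ?M = "adjoin (adjoin Fbar ?E) {t n}"
  have Fbar: "Fbar \<subseteq> ?M" and E: "?E \<subseteq> ?M" and t: "t n \<in> ?M"
    by (auto intro: generate_field.incl)
  have "adjoin (base_field F t j) {y} \<union> t ` {j+1..n - 1} \<subseteq> ?E"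
    unfolding upper_field_def by (rule subset_generate_field)
  moreover have "{j+1..n} = insert n {j+1..n - 1}" using assms by auto
  ultimately have "upper_field F t j y n \<subseteq> ?M"
    unfolding upper_field_def[of _ _ _ _ n] using E t
    by (intro generate_field_subset[OF subfield_generate_field]) auto
  then have "adjoin Fbar (upper_field F t j y n) \<subseteq> ?M"
    using Fbar by (intro generate_field_subset[OF subfield_generate_field]) auto
  then show ?thesis using generated by auto
qed

end

section \<open>Residues at both kinds of normal places\<close>

theorem theorem7p4:
  fixes F Fbar L FA B :: "'a::field_char_0 set" and D :: "'a \<Rightarrow> 'a" and t :: "nat \<Rightarrow> 'a"
    and q y f \<pi> :: 'a and m j n :: nat and val :: "'a \<Rightarrow> int"
  assumes tower: "differential_tower F Fbar D t q y m j n"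
    and L: "L = upper_field F t j y n"
    and FA: "FA = ring_FA F Fbar t j y n"
    and place:
      "(\<exists>P. height_one_prime FA P \<and> prime_valuation FA P val \<and> B = FA \<and> normal_place D B val) \<or>
       (hypertangent F D t y j n \<and>
        degree_valuation (adjoin Fbar (upper_field F t j y (n - 1))) (t n) val \<and>
        B = valuation_ring val)"
    and \<pi>: "uniformiser val \<pi>"
    and f: "f \<in> L - {0}"
    and f_val: "ext_val val f \<ge> - delta D B val"
  shows
    "(residue D val \<pi> f \<in> carrier (residue_field val) \<and>
      (\<forall>\<pi>'. uniformiser val \<pi>' \<longrightarrow>
         D \<pi>' \<noteq> 0 \<and> f * (\<pi>' / D \<pi>') \<in> valuation_ring val \<and>
         residue D val \<pi>' f = residue D val \<pi> f) \<and>
      (\<forall>h (e :: int). h \<noteq> 0 \<longrightarrow> val h = e \<longrightarrow> e \<noteq> 0 \<longrightarrow>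
         D h \<noteq> 0 \<and> f * (h / D h) \<in> valuation_ring val \<and>
         residue D val \<pi> f = [e] \<cdot>\<^bsub>residue_field val\<^esub> residue_class val (f * (h / D h))))
     \<and>
     (residue D val \<pi> f \<noteq> \<zero>\<^bsub>residue_field val\<^esub> \<longleftrightarrow> ext_val val f = - delta D B val)
     \<and>
     (has_elementary_integral TYPE('b::field) L D f \<longrightarrow>
      (\<forall>v r c u. represents L Fbar D f v r c u \<longrightarrow>
         property_A FA D f v \<longrightarrow> property_B FA D f r u \<longrightarrow>
         (\<Sum>i=1..r. c i * of_int (val (u i))) \<in> Fbar \<and>
         residue D val \<pi> f = residue_class val (\<Sum>i=1..r. c i * of_int (val (u i)))))"
proof -
  interpret T: differential_tower F Fbar D t q y m j n by (rule tower)
  have D: "derivation D" by (rule T.D_derivation)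
  have Fbar: "subfield Fbar ring_of_type_algebra" by (rule T.Fbar_subfield)
  \<comment> \<open>Both kinds of places are reduced to one \<open>normal_valuation\<close> whose
    \<open>h0\<close> has value \<eta>; at infinity the witness is 1, of value 0.\<close>
  have "Fbar \<subseteq> valuation_ring val \<and>
    (\<exists>h0. normal_valuation val D h0 \<and> eta D B val = ereal (of_int (val h0)))"
    using place
  proof (elim disjE exE conjE)
    fix P assume P: "height_one_prime FA P" "prime_valuation FA P val" "B = FA" "normal_place D B val"
    have "Fbar \<subseteq> FA" unfolding FA ring_FA_def by (auto intro: generate_ring.incl)
    then show ?thesis
      using normal_valuation_prime[OF D P(1,2) _ Fbar] P(3,4) by blast
  next
    assume ht: "hypertangent F D t y j n" and B: "B = valuation_ring val"
      and deg: "degree_valuation (adjoin Fbar (upper_field F t j y (n - 1))) (t n) val"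
    let ?K = "adjoin Fbar (upper_field F t j y (n - 1))"
    obtain w where jn: "j < n" and w: "w \<in> upper_field F t j y (n - 1)" "w \<noteq> 0"
      "D (t n) = w * (1 + (t n)\<^sup>2)"
      using ht unfolding hypertangent_def by blast
    have wK: "w \<in> ?K" and FK: "Fbar \<subseteq> ?K" using w(1) by (auto intro: generate_field.incl)
    note inf = normal_valuation_infinity[OF D subfield_generate_field
        T.const_upper_field_closed deg T.adjoin_top_variable[OF jn] wK w(2,3)]
    interpret N: normal_valuation val D 1 by (rule inf(2)) simp
    show ?thesis using inf FK N.normal_valuation_axioms B
      by (intro conjI exI[of _ 1]) auto
  qed
  then obtain h0 where FbarO: "Fbar \<subseteq> valuation_ring val" and N: "normal_valuation val D h0"
    and eta: "eta D B val = ereal (of_int (val h0))" by blast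
  interpret N: normal_valuation val D h0 by (rule N)
  have delta: "- delta D B val = ereal (of_int (- 1 - val h0))"
    by (simp add: delta_def eta one_ereal_def)
  have fv: "val_ge val (- 1 - val h0) f"
    using f_val unfolding delta val_ge_ext_val .
  have f0: "f \<noteq> 0" using f by simp
  have unif: "p \<noteq> 0" "val p = 1" if "uniformiser val p" for p
    using that by (auto simp: uniformiser_def)
  have res: "val_ge val 0 (f * (\<pi> / D \<pi>))"
    using N.val_ge_residue(2)[OF fv] unif[OF \<pi>] by simp
  have i1: "residue D val \<pi> f \<in> carrier (residue_field val)"
    unfolding residue_def by (rule N.residue_class_carrier[OF res])
  have i2: "D \<pi>' \<noteq> 0 \<and> f * (\<pi>' / D \<pi>') \<in> valuation_ring val \<and>
      residue D val \<pi>' f = residue D val \<pi> f" if "uniformiser val \<pi>'" for \<pi>'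
  proof (intro conjI)
    show "D \<pi>' \<noteq> 0" "f * (\<pi>' / D \<pi>') \<in> valuation_ring val"
      using N.val_ge_residue[OF fv, of \<pi>'] unif[OF that] by (simp_all add: valuation_ring_iff)
    show "residue D val \<pi>' f = residue D val \<pi> f"
      \<comment> \<open>The congruence with \<pi> in the role of \<open>x\<close>, where the factor
        \<open>of_int (val \<pi>)\<close> is 1.\<close>
      unfolding residue_def using N.residue_cong[OF fv that, of \<pi>] unif[OF \<pi>]
      by (intro N.residue_class_eqI) simp
  qed
  have i3: "D h \<noteq> 0 \<and> f * (h / D h) \<in> valuation_ring val \<and>
      residue D val \<pi> f = [e] \<cdot>\<^bsub>residue_field val\<^esub> residue_class val (f * (h / D h))"
    if "h \<noteq> 0" "val h = e" "e \<noteq> 0" for h and e :: int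
  proof -
    have h: "D h \<noteq> 0" "val_ge val 0 (f * (h / D h))"
      using N.val_ge_residue[OF fv, of h] that by auto
    have "residue_class val (f * (\<pi> / D \<pi>)) = residue_class val (of_int e * (f * (h / D h)))"
      using N.residue_cong[OF fv \<pi>, of h] that by (intro N.residue_class_eqI) simp
    then show ?thesis
      using h by (simp add: residue_def valuation_ring_iff N.residue_class_int_mult)
  qed
  have ii: "residue D val \<pi> f \<noteq> \<zero>\<^bsub>residue_field val\<^esub> \<longleftrightarrow> ext_val val f = - delta D B val"
    unfolding residue_def N.residue_class_eq_zero N.residue_eq_zero_iff[OF fv f0 \<pi>] delta
    using f0 by (simp add: ext_val_def del: of_int_diff of_int_minus)
  have iii: "(\<Sum>i=1..r. c i * of_int (val (u i))) \<in> Fbar \<and>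
      residue D val \<pi> f = residue_class val (\<Sum>i=1..r. c i * of_int (val (u i)))"
    if rep: "represents L Fbar D f v r c u" for v r c u
  proof
    have c: "c i \<in> Fbar" "u i \<noteq> 0" if "i \<in> {1..r}" for i
      using rep that unfolding represents_def by blast+
    then show "(\<Sum>i=1..r. c i * of_int (val (u i))) \<in> Fbar"
      by (intro subfield_sum[OF Fbar] subfieldD(4)[OF Fbar] subfield_of_int[OF Fbar])
    \<comment> \<open>Constants are integral at the place, as required for bounding the sum of
      logarithmic derivatives.\<close>
    have "val_ge val 0 (c i)" if "i \<in> {1..r}" for i
      using c(1)[OF that] FbarO by (auto simp flip: valuation_ring_iff)
    moreover have "f = D v + (\<Sum>i\<in>{1..r}. c i * (D (u i) / u i))"
      using rep unfolding represents_def by blast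
    ultimately show "residue D val \<pi> f = residue_class val (\<Sum>i=1..r. c i * of_int (val (u i)))"
      unfolding residue_def using c(2)
      by (intro N.residue_class_eqI N.residue_representation[OF fv \<pi>])
  qed
  show ?thesis using i1 i2 i3 ii iii by blast
qed

end
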